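(* Let $G\cong\Gamma(\mathbb{Z}_n)$ be the comaximal graph of order $n$, and let $G_2$ be the graph associated with $n$ defined in the context. Then the following hold. (i) If $n$ is a product of distinct primes, then the independence polynomial of $G$ is $$I(G,x)=\phi(n)x+(1+x)\,I(G_2,x),$$ where $I(G_2,x)$ is the independence polynomial of $G_2$. (ii) If $n=\prod_{i=1}^{k}p_i^{n_i}$, where $p_1,\dots,p_k$ are distinct primes and $n_1,\dots,n_k$ are positive integers, then the independence polynomial of $G$ is $$I(G,x)=\phi(n)x+(1+x)^{p_1^{n_1-1}p_2^{n_2-1}\cdots p_k^{n_k-1}}\,I(G_2,x),$$ where $I(G_2,x)$ is the independence polynomial of $G_2$.
   Context: For a commutative ring $R$ with identity $1\ne 0$, the comaximal graph $\Gamma(R)$ is the simple graph with vertex set $R$ in which two distinct vertices $a,b$ are adjacent if and only if $aR+bR=R$. $\mathbb{Z}_n$ is the ring of integers modulo $n$, and $\phi$ is Euler's totient function. An independent set of a graph $G$ is a set of pairwise non-adjacent vertices. The independence polynomial is $I(G,x)=\sum_{k=0}^{\alpha(G)}c_kx^k$, where $c_k$ is the number of independent sets of $G$ of cardinality $k$ (with $c_0=1$ for the empty set) and $\alpha(G)$ is the largest cardinality of an independent set. Let $d_1,\dots,d_t$ be the distinct proper divisors of $n$ (divisors other than $1$ and $n$). $G_n$ is the simple graph with vertex set $\{d_1,\dots,d_t\}$ in which distinct $d_i,d_j$ are adjacent if and only if $\gcd(d_i,d_j)=1$. The graph $G_2=G_n\big[\overline{K}_{\phi(n/d_1)},\dots,\overline{K}_{\phi(n/d_t)}\big]$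 is the joined union: each vertex $d_i$ of $G_n$ is replaced by an edgeless graph $\overline{K}_{\phi(n/d_i)}$ on $\phi(n/d_i)$ vertices, and every vertex of the part replacing $d_i$ is joined to every vertex of the part replacing $d_j$ exactly when $d_i$ and $d_j$ are adjacent in $G_n$. With this notation $\Gamma(\mathbb{Z}_n)=K_{\phi(n)}\vee(K_1\cup G_2)$, where $K_m$ is the complete graph on $m$ vertices, $\cup$ is disjoint union, and $\vee$ is the join (disjoint union together with all edges between the two graphs).
   Formalization: In (ii), G_2 is replaced by G_2 with its isolated vertices removed, since (ii) with the full G_2 fails for non-squarefree n (n=4: true polynomial 1+4x+x^2, the formula gives 2x+(1+x)^3); for squarefree n nothing is removed. *)

theory Defs
  imports
    "Graph_Theory.Graph_Theory"
    "HOL-Number_Theory.Number_Theory"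
    "HOL-Computational_Algebra.Polynomial"
begin

text \<open>
  Following \<open>Graph_Theory\<close>, a simple graph is a symmetric loop-free digraph without
  parallel arcs: every edge between \<open>u\<close> and \<open>v\<close> is the pair of arcs \<open>(u, v)\<close>, \<open>(v, u)\<close>.
\<close>

definition comaximal_graph :: "('a, 'm) ring_scheme \<Rightarrow> 'a pair_pre_digraph" where
  "comaximal_graph R = \<lparr>
     pverts = carrier R,
     parcs = {(a, b). a \<in> carrier R \<and> b \<in> carrier R \<and> a \<noteq> b \<and>
                      PIdl\<^bsub>R\<^esub> a <+>\<^bsub>R\<^esub> PIdl\<^bsub>R\<^esub> b = carrier R} \<rparr>"

definition independent_set :: "('a, 'b) pre_digraph \<Rightarrow> 'a set \<Rightarrow> bool" where
  "independent_set G S \<longleftrightarrow> S \<subseteq> verts G \<and> (\<forall>u\<in>S. \<forall>v\<in>S. \<not> u \<rightarrow>\<^bsub>G\<^esub> v)"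

text \<open>The next three definitions are meant for graphs with finitely many vertices.\<close>

definition independence_number :: "('a, 'b) pre_digraph \<Rightarrow> nat" where
  "independence_number G = Max {card S | S. independent_set G S}"

definition num_independent_sets :: "('a, 'b) pre_digraph \<Rightarrow> nat \<Rightarrow> nat" where
  "num_independent_sets G k = card {S. independent_set G S \<and> card S = k}"

definition independence_poly :: "('a, 'b) pre_digraph \<Rightarrow> int poly" where
  "independence_poly G =
     (\<Sum>k = 0..independence_number G. monom (int (num_independent_sets G k)) k)"

definition edgeless_graph :: "nat \<Rightarrow> nat pair_pre_digraph" where
  "edgeless_graph m = \<lparr> pverts = {..<m}, parcs = {} \<rparr>"

text \<open>
  The joined union \<open>G[H\<^sub>1, \<dots>, H\<^sub>t]\<close>: the vertex \<open>(i, u)\<close> is the vertex \<open>u\<close> of the copy of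
  \<open>H i\<close> that replaces the vertex \<open>i\<close> of \<open>G\<close>.
\<close>

definition joined_union ::
  "'i pair_pre_digraph \<Rightarrow> ('i \<Rightarrow> 'a pair_pre_digraph) \<Rightarrow> ('i \<times> 'a) pair_pre_digraph" where
  "joined_union G H = \<lparr>
     pverts = Sigma (pverts G) (\<lambda>i. pverts (H i)),
     parcs = {((i, u), (j, v)). i \<in> pverts G \<and> j \<in> pverts G \<and>
                u \<in> pverts (H i) \<and> v \<in> pverts (H j) \<and>
                ((i, j) \<in> parcs G \<or> (i = j \<and> (u, v) \<in> parcs (H i)))} \<rparr>"

definition proper_divisors :: "nat \<Rightarrow> nat set" where
  "proper_divisors n = {d. d dvd n \<and> d \<noteq> 1 \<and> d \<noteq> n}"

definition coprime_divisor_graph :: "nat \<Rightarrow> nat pair_pre_digraph" where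
  "coprime_divisor_graph n = \<lparr>
     pverts = proper_divisors n,
     parcs = {(d, d'). d \<in> proper_divisors n \<and> d' \<in> proper_divisors n \<and>
                       d \<noteq> d' \<and> gcd d d' = 1} \<rparr>"

definition G2 :: "nat \<Rightarrow> (nat \<times> nat) pair_pre_digraph" where
  "G2 n = joined_union (coprime_divisor_graph n) (\<lambda>d. edgeless_graph (totient (n div d)))"

text \<open>
  The vertices of \<^term>\<open>G2 n\<close> correspond to the nonzero non-units of the integers modulo
  \<open>n\<close>, and its isolated vertices to the nonzero nilpotent elements. For
  \<open>n = (\<Prod>i. p\<^sub>i ^ e\<^sub>i)\<close> there are \<open>(\<Prod>i. p\<^sub>i ^ (e\<^sub>i - 1)) - 1\<close> of the latter. A factor
  \<open>(1 + x) ^ (\<Prod>i. p\<^sub>i ^ (e\<^sub>i - 1))\<close> of the independence polynomial already accounts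
  for them (and for \<open>0\<close>), so next to that factor they must not be counted a second time in the
  remaining graph. If \<open>n\<close> is squarefree, nothing is removed.
\<close>

definition remove_isolated :: "('a, 'b) pre_digraph \<Rightarrow> ('a, 'b) pre_digraph" where
  "remove_isolated G = G \<restriction> {v \<in> verts G. \<exists>w \<in> verts G. v \<rightarrow>\<^bsub>G\<^esub> w}"

end

theory Submission
  imports Defs
begin

text \<open>
  A unit of \<open>\<int>\<^sub>n\<close> is adjacent to every other vertex, so it lies in no independent set besides
  its singleton: the units contribute \<open>\<phi>(n) x\<close>. Among the non-units \<open>0\<close> is isolated and
  splits off a factor \<open>1 + x\<close>. Whether \<open>a\<close> and \<open>b\<close> are comaximal depends only on
  \<open>gcd a n\<close> and \<open>gcd b n\<close>, so the nonzero non-units form a copy of \<open>G\<^sub>2\<close>. The isolated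
  vertices of \<open>G\<^sub>2\<close> are the nonzero multiples of the radical \<open>r\<close> of \<open>n\<close>, and each of these
  \<open>n/r - 1\<close> vertices splits off another factor \<open>1 + x\<close>.
\<close>

section \<open>Independence polynomials as sums over independent sets\<close>

lemma independent_set_finite:
  assumes "finite (verts G)" "independent_set G S"
  shows "finite S"
  using assms finite_subset by (auto simp: independent_set_def)

lemma finite_independent_sets:
  assumes "finite (verts G)"
  shows "finite {S. independent_set G S}"
  by (rule finite_subset[of _ "Pow (verts G)"]) (auto simp: independent_set_def assms)

text \<open>Grouping the independent sets by cardinality recovers the coefficients; finiteness makes
  the maximum a bound for all cardinalities. With one monomial per independent set, a bijection
  between families of independent sets becomes an identity of polynomials.\<close>

lemma independence_poly_altdef:
  assumes "finite (verts G)"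
  shows "independence_poly G = (\<Sum>S | independent_set G S. monom 1 (card S))"
proof -
  let ?I = "{S. independent_set G S}"
  have fin: "finite ?I" by (rule finite_independent_sets[OF assms])
  have "finite {card S | S. independent_set G S}"
    using fin by (simp add: setcompr_eq_image)
  then have sub: "card ` ?I \<subseteq> {0..independence_number G}"
    by (auto simp: independence_number_def intro!: Max_ge)
  have "independence_poly G =
      (\<Sum>k = 0..independence_number G. \<Sum>S | S \<in> ?I \<and> card S = k. monom 1 (card S))"
    unfolding independence_poly_def num_independent_sets_def
    by (intro sum.cong refl) (simp add: of_nat_poly mult_monom smult_monom flip: monom_0)
  also have "\<dots> = (\<Sum>S\<in>?I. monom 1 (card S))"
    by (rule sum.group[OF fin _ sub]) simp
  finally show ?thesis .
qed

text \<open>Taking images under \<open>f\<close> is a size-preserving bijection between the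
  independent sets. Only adjacency of vertices is compared, so the two graphs may have different
  types of arcs.\<close>

lemma independence_poly_cong:
  assumes "finite (verts G)" and f: "bij_betw f (verts G) (verts H)"
    and adj: "\<And>u v. u \<in> verts G \<Longrightarrow> v \<in> verts G \<Longrightarrow> u \<rightarrow>\<^bsub>G\<^esub> v \<longleftrightarrow> f u \<rightarrow>\<^bsub>H\<^esub> f v"
  shows "independence_poly G = independence_poly H"
proof -
  have inj: "inj_on f S" if "S \<subseteq> verts G" for S
    using that f by (meson bij_betw_imp_inj_on inj_on_subset)
  have "finite (verts H)" using assms(1) f bij_betw_finite by blast
  have indep: "independent_set G S \<longleftrightarrow> independent_set H (f ` S)" if "S \<subseteq> verts G" for S
  proof -
    have "f ` S \<subseteq> verts H" using that f by (auto simp: bij_betw_def)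
    then show ?thesis
      using that adj unfolding independent_set_def by (simp add: subset_iff)
  qed
  have "bij_betw (image f) {S. independent_set G S} {S. independent_set H S}"
    unfolding bij_betw_def
  proof
    show "inj_on (image f) {S. independent_set G S}"
      by (rule inj_on_subset[OF inj_on_image_Pow[OF inj[OF subset_refl]]])
        (auto simp: independent_set_def)
    show "image f ` {S. independent_set G S} = {S. independent_set H S}"
    proof (intro equalityI subsetI)
      fix T assume T: "T \<in> {S. independent_set H S}"
      then have "T \<subseteq> f ` verts G" using f by (simp add: independent_set_def bij_betw_def)
      then obtain S where "S \<subseteq> verts G" "T = f ` S" by (meson subset_imageE)
      with T indep show "T \<in> image f ` {S. independent_set G S}" by auto
    qed (use indep in \<open>auto simp: independent_set_def\<close>)
  qed
  then have "(\<Sum>S | independent_set H S. (monom 1 (card S) :: int poly)) =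
      (\<Sum>S | independent_set G S. monom 1 (card (f ` S)))"
    by (rule sum.reindex_bij_betw[symmetric])
  also have "\<dots> = (\<Sum>S | independent_set G S. monom 1 (card S))"
    by (intro sum.cong) (auto simp: card_image inj independent_set_def)
  finally have "(\<Sum>S | independent_set G S. monom 1 (card S)) =
      (\<Sum>S | independent_set H S. (monom 1 (card S) :: int poly))" ..
  with assms(1) \<open>finite (verts H)\<close> show ?thesis by (simp add: independence_poly_altdef)
qed

section \<open>Splitting off isolated and universal vertices\<close>

lemma dominates_induce_subgraph [simp]:
  "u \<rightarrow>\<^bsub>G \<restriction> W\<^esub> v \<longleftrightarrow> u \<in> W \<and> v \<in> W \<and> u \<rightarrow>\<^bsub>G\<^esub> v"
  by (auto simp: arcs_ends_conv induce_subgraph_def)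

lemma independent_set_induce_subgraph:
  assumes "W \<subseteq> verts G"
  shows "independent_set (G \<restriction> W) S \<longleftrightarrow> S \<subseteq> W \<and> independent_set G S"
  using assms by (auto simp: independent_set_def subset_iff)

text \<open>This is the contribution of an edgeless vertex set: in the expansion of the product of
  the factors x + 1 over \<open>A\<close>, the subset \<open>S\<close> records the factors that
  contribute x.\<close>

lemma sum_Pow_monom_card:
  assumes "finite A"
  shows "(\<Sum>S\<in>Pow A. monom 1 (card S)) = ([:1, 1:] :: 'a::comm_semiring_1 poly) ^ card A"
proof -
  have "([:1, 1:] :: 'a poly) ^ card A = (\<Prod>x\<in>A. monom 1 1 + 1)"
    by (simp add: monom_altdef one_pCons)
  also have "\<dots> = (\<Sum>S\<in>Pow A. (\<Prod>x\<in>S. monom 1 1) * (\<Prod>x\<in>A - S. 1))"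
    by (rule prod_add[OF assms])
  also have "\<dots> = (\<Sum>S\<in>Pow A. monom 1 (card S))"
    by (simp add: monom_power)
  finally show ?thesis by simp
qed

text \<open>An independent set \<open>S\<close> splits uniquely into \<open>S \<inter> Z\<close> and
  \<open>S - Z\<close>. The first part is an arbitrary subset of \<open>Z\<close>, and cardinalities
  add, so the sum factors. Arcs are excluded in both directions because \<open>G\<close> may be any
  digraph.\<close>

lemma independence_poly_isolated:
  assumes fin: "finite (verts G)" and Z: "Z \<subseteq> verts G"
    and iso: "\<And>z v. z \<in> Z \<Longrightarrow> v \<in> verts G \<Longrightarrow> \<not> z \<rightarrow>\<^bsub>G\<^esub> v \<and> \<not> v \<rightarrow>\<^bsub>G\<^esub> z"
  shows "independence_poly G = [:1, 1:] ^ card Z * independence_poly (G \<restriction> (verts G - Z))"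
proof -
  let ?H = "G \<restriction> (verts G - Z)"
  let ?I = "{S. independent_set ?H S}"
  have indep: "independent_set ?H S \<longleftrightarrow> S \<subseteq> verts G - Z \<and> independent_set G S" for S
    by (rule independent_set_induce_subgraph) auto
  have finZ: "finite Z" using fin Z finite_subset by blast
  have bij: "bij_betw (\<lambda>(T, S). T \<union> S) (Pow Z \<times> ?I) {S. independent_set G S}"
    by (rule bij_betw_byWitness[where f' = "\<lambda>S. (S \<inter> Z, S - Z)"])
      (use Z iso in \<open>auto simp: indep independent_set_def subset_iff\<close>)
  have "independence_poly G = (\<Sum>S | independent_set G S. monom 1 (card S))"
    by (rule independence_poly_altdef[OF fin])
  also have "\<dots> = (\<Sum>(T, S)\<in>Pow Z \<times> ?I. monom 1 (card (T \<union> S)))"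
    by (subst sum.reindex_bij_betw[OF bij, symmetric]) (simp add: case_prod_unfold)
  also have "\<dots> = (\<Sum>(T, S)\<in>Pow Z \<times> ?I. monom 1 (card T) * monom 1 (card S))"
  proof (intro sum.cong refl, clarify)
    fix T S assume "T \<subseteq> Z" "independent_set ?H S"
    then have "T \<inter> S = {}" "finite T" "finite S"
      using finZ finite_subset independent_set_finite[OF fin] by (auto simp: indep)
    then show "monom 1 (card (T \<union> S)) = monom 1 (card T) * (monom 1 (card S) :: int poly)"
      by (simp add: card_Un_disjoint mult_monom)
  qed
  also have "\<dots> = (\<Sum>T\<in>Pow Z. monom 1 (card T)) * (\<Sum>S\<in>?I. monom 1 (card S))"
    by (simp add: sum_product sum.cartesian_product)
  also have "\<dots> = [:1, 1:] ^ card Z * independence_poly ?H"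
    using fin finZ by (simp add: sum_Pow_monom_card independence_poly_altdef)
  finally show ?thesis .
qed

text \<open>\<open>remove_isolated\<close> looks at outgoing arcs; symmetry rules out incoming ones
  too, so the deleted vertices are isolated in the two-sided sense.\<close>

lemma independence_poly_remove_isolated:
  assumes "finite (verts G)" "symmetric G"
  shows "independence_poly G =
    [:1, 1:] ^ card {v \<in> verts G. \<forall>w\<in>verts G. \<not> v \<rightarrow>\<^bsub>G\<^esub> w} * independence_poly (remove_isolated G)"
proof -
  let ?Z = "{v \<in> verts G. \<forall>w\<in>verts G. \<not> v \<rightarrow>\<^bsub>G\<^esub> w}"
  have "verts G - ?Z = {v \<in> verts G. \<exists>w\<in>verts G. v \<rightarrow>\<^bsub>G\<^esub> w}" by auto
  then have "remove_isolated G = G \<restriction> (verts G - ?Z)" by (simp add: remove_isolated_def)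
  moreover have "independence_poly G =
      [:1, 1:] ^ card ?Z * independence_poly (G \<restriction> (verts G - ?Z))"
    by (rule independence_poly_isolated)
      (use assms arcs_ends_symmetric[OF assms(2)] in auto)
  ultimately show ?thesis by simp
qed

text \<open>An independent set that contains some \<open>u\<close> in \<open>U\<close> is the
  singleton of \<open>u\<close>, and each such singleton is independent because \<open>u\<close> has
  no loop. All other independent sets avoid \<open>U\<close>.\<close>

lemma independence_poly_universal:
  assumes fin: "finite (verts G)" and U: "U \<subseteq> verts G"
    and loopfree: "\<And>u. u \<in> U \<Longrightarrow> \<not> u \<rightarrow>\<^bsub>G\<^esub> u"
    and univ: "\<And>u v. u \<in> U \<Longrightarrow> v \<in> verts G \<Longrightarrow> u \<noteq> v \<Longrightarrow> u \<rightarrow>\<^bsub>G\<^esub> v"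
  shows "independence_poly G =
    monom (int (card U)) 1 + independence_poly (G \<restriction> (verts G - U))"
proof -
  let ?H = "G \<restriction> (verts G - U)"
  have indep: "independent_set ?H S \<longleftrightarrow> S \<subseteq> verts G - U \<and> independent_set G S" for S
    by (rule independent_set_induce_subgraph) auto
  have "S = {u}" if "independent_set G S" "u \<in> S" "u \<in> U" for S u
    using that univ unfolding independent_set_def by blast
  then have split: "{S. independent_set G S} = (\<lambda>u. {u}) ` U \<union> {S. independent_set ?H S}"
    using U loopfree by (auto simp: indep) (auto simp: independent_set_def)
  have finU: "finite U" using fin U finite_subset by blast
  have "independence_poly G = (\<Sum>S\<in>(\<lambda>u. {u}) ` U. monom 1 (card S)) + independence_poly ?H"
    using fin finU
    by (simp add: independence_poly_altdef split, intro sum.union_disjoint)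
       (auto simp: finite_independent_sets indep)
  also have "(\<Sum>S\<in>(\<lambda>u. {u}) ` U. monom 1 (card S)) = monom (int (card U)) 1"
    by (subst sum.reindex) (auto simp: of_nat_poly smult_monom)
  finally show ?thesis .
qed

section \<open>The comaximal graph of the integers modulo n\<close>

text \<open>An isomorphism also maps arcs; this keeps only its effect on vertices and adjacency.
  Well-formedness places the ends of all arcs in \<open>verts G\<close>, where the vertex map is
  injective, so adjacency is reflected as well as preserved.\<close>

lemma digraph_isoE:
  assumes "digraph_iso G H"
  obtains f where "bij_betw f (verts G) (verts H)"
    and "\<And>u v. u \<in> verts G \<Longrightarrow> v \<in> verts G \<Longrightarrow> u \<rightarrow>\<^bsub>G\<^esub> v \<longleftrightarrow> f u \<rightarrow>\<^bsub>H\<^esub> f v"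
proof -
  from assms obtain h where h: "pre_digraph.digraph_isomorphism G h" and H: "H = app_iso h G"
    by (auto simp: digraph_iso_def)
  from h have wf: "wf_digraph G" and inj: "inj_on (iso_verts h) (verts G)"
    and ends: "\<And>a. a \<in> arcs G \<Longrightarrow> iso_tail h (iso_arcs h a) = iso_verts h (tail G a) \<and>
      iso_head h (iso_arcs h a) = iso_verts h (head G a)"
    by (auto simp: pre_digraph.digraph_isomorphism_def)
  show thesis
  proof (rule that)
    show "bij_betw (iso_verts h) (verts G) (verts H)" using inj by (simp add: H bij_betw_def)
    have "arcs_ends H = map_prod (iso_verts h) (iso_verts h) ` arcs_ends G"
      by (force simp: arcs_ends_conv H ends image_image)
    moreover have "arcs_ends G \<subseteq> verts G \<times> verts G"
      using wf by (auto simp: arcs_ends_conv wf_digraph_def)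
    ultimately show "u \<rightarrow>\<^bsub>G\<^esub> v \<longleftrightarrow> iso_verts h u \<rightarrow>\<^bsub>H\<^esub> iso_verts h v"
      if "u \<in> verts G" "v \<in> verts G" for u v
      using inj that by (force simp: inj_on_eq_iff)
  qed
qed

text \<open>The ideal sum is the whole ring iff it contains 1, that is, iff 1 is a combination of
  \<open>a\<close> and \<open>b\<close> modulo \<open>m\<close>. By Bezout the combinations are the
  multiples of \<open>gcd a b\<close>, so this gcd must be invertible modulo
  \<open>m\<close>.\<close>

lemma (in residues) comaximal_iff:
  assumes a: "a \<in> carrier R" and b: "b \<in> carrier R"
  shows "PIdl\<^bsub>R\<^esub> a <+>\<^bsub>R\<^esub> PIdl\<^bsub>R\<^esub> b = carrier R \<longleftrightarrow> coprime (gcd a b) m"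
proof -
  interpret cring R by (rule cring)
  interpret I: ideal "PIdl\<^bsub>R\<^esub> a <+>\<^bsub>R\<^esub> PIdl\<^bsub>R\<^esub> b" R
    by (intro add_ideals cgenideal_ideal a b)
  have one_eq: "(\<one> = r \<otimes> a \<oplus>\<^bsub>R\<^esub> s \<otimes> b) \<longleftrightarrow> [r * a + s * b = 1] (mod m)" for r s
    unfolding res_add_eq res_mult_eq res_one_eq cong_def mod_add_eq
    using m_gt_one by (simp add: eq_commute[of 1])
  have "PIdl\<^bsub>R\<^esub> a <+>\<^bsub>R\<^esub> PIdl\<^bsub>R\<^esub> b = carrier R \<longleftrightarrow> \<one> \<in> PIdl\<^bsub>R\<^esub> a <+>\<^bsub>R\<^esub> PIdl\<^bsub>R\<^esub> b"
    using I.one_imp_carrier by auto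
  also have "\<dots> \<longleftrightarrow> (\<exists>r\<in>carrier R. \<exists>s\<in>carrier R. \<one> = r \<otimes> a \<oplus>\<^bsub>R\<^esub> s \<otimes> b)"
    unfolding set_add_def set_mult_def cgenideal_def by simp blast
  also have "\<dots> \<longleftrightarrow> (\<exists>r\<in>carrier R. \<exists>s\<in>carrier R. [r * a + s * b = 1] (mod m))"
    by (simp only: one_eq)
  also have "\<dots> \<longleftrightarrow> (\<exists>r s. [r * a + s * b = 1] (mod m))"
  proof
    assume "\<exists>r s. [r * a + s * b = 1] (mod m)"
    then obtain r s where rs: "[r * a + s * b = 1] (mod m)" by blast
    \<comment> \<open>Reducing the integer coefficients modulo \<open>m\<close> brings them into the
      carrier.\<close>
    have "[(r mod m) * a + (s mod m) * b = r * a + s * b] (mod m)"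
      by (intro cong_add cong_mult) (simp_all add: cong_def)
    from cong_trans[OF this rs]
    show "\<exists>r\<in>carrier R. \<exists>s\<in>carrier R. [r * a + s * b = 1] (mod m)"
      using mod_in_carrier by blast
  qed blast
  also have "\<dots> \<longleftrightarrow> coprime (gcd a b) m"
  proof
    assume "\<exists>r s. [r * a + s * b = 1] (mod m)"
    then obtain r s where rs: "[r * a + s * b = 1] (mod m)" by blast
    show "coprime (gcd a b) m"
    proof (rule coprimeI)
      \<comment> \<open>The combination is 0 modulo \<open>c\<close> because \<open>c\<close>
        divides \<open>a\<close> and \<open>b\<close>, and 1 modulo \<open>c\<close> because
        \<open>c\<close> divides \<open>m\<close>.\<close>
      fix c assume "c dvd gcd a b" and cm: "c dvd m"
      then have "c dvd r * a + s * b" by simp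
      moreover have "[r * a + s * b = 1] (mod c)" using rs cm cong_dvd_modulus by blast
      ultimately show "is_unit c" by (simp add: cong_dvd_iff)
    qed
  next
    assume "coprime (gcd a b) m"
    then obtain t where t: "[gcd a b * t = 1] (mod m)" using cong_solve_coprime_int by blast
    \<comment> \<open>The coefficients come from a Bezout identity for the gcd, scaled by its
      inverse \<open>t\<close> modulo \<open>m\<close>.\<close>
    obtain u v where uv: "u * a + v * b = gcd a b" using bezout_int by blast
    have "(t * u) * a + (t * v) * b = gcd a b * t"
      unfolding uv[symmetric] by (simp add: algebra_simps)
    with t show "\<exists>r s. [r * a + s * b = 1] (mod m)" by metis
  qed
  finally show ?thesis .
qed

text \<open>A model of the comaximal graph on natural representatives, with the ideal condition
  replaced by its arithmetic form, so that facts about \<open>gcd\<close> and \<open>totient\<close>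
  on \<open>nat\<close> apply directly.\<close>

definition comaximal_nat :: "nat \<Rightarrow> nat pair_pre_digraph" where
  "comaximal_nat n = \<lparr> pverts = {..<n},
     parcs = {(a, b). a < n \<and> b < n \<and> a \<noteq> b \<and> coprime (gcd a b) n} \<rparr>"

lemma comaximal_graph_residue_ring:
  assumes "n \<ge> 2"
  shows "bij_betw nat (pverts (comaximal_graph (residue_ring (int n)))) (pverts (comaximal_nat n))"
    and "a \<in> pverts (comaximal_graph (residue_ring (int n))) \<Longrightarrow>
      b \<in> pverts (comaximal_graph (residue_ring (int n))) \<Longrightarrow>
      (a, b) \<in> parcs (comaximal_graph (residue_ring (int n))) \<longleftrightarrow>
      (nat a, nat b) \<in> parcs (comaximal_nat n)"
proof -
  interpret residues "int n" "residue_ring (int n)"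
    by unfold_locales (use assms in auto)
  show "bij_betw nat (pverts (comaximal_graph (residue_ring (int n)))) (pverts (comaximal_nat n))"
    by (rule bij_betw_byWitness[where f' = int])
      (auto simp: comaximal_graph_def comaximal_nat_def res_carrier_eq)
  assume ab: "a \<in> pverts (comaximal_graph (residue_ring (int n)))"
    "b \<in> pverts (comaximal_graph (residue_ring (int n)))"
  then obtain a' b' where "a = int a'" "b = int b'"
    by (auto simp: comaximal_graph_def res_carrier_eq) (metis nonneg_int_cases)
  moreover from this ab have "PIdl\<^bsub>residue_ring (int n)\<^esub> a
      <+>\<^bsub>residue_ring (int n)\<^esub> PIdl\<^bsub>residue_ring (int n)\<^esub> b =
      carrier (residue_ring (int n)) \<longleftrightarrow> coprime (gcd a' b') n"
    by (simp add: comaximal_graph_def comaximal_iff)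
  ultimately show "(a, b) \<in> parcs (comaximal_graph (residue_ring (int n))) \<longleftrightarrow>
      (nat a, nat b) \<in> parcs (comaximal_nat n)"
    using ab by (simp add: comaximal_graph_def comaximal_nat_def) (auto simp: res_carrier_eq)
qed

text \<open>The residue 0 is left out on purpose: it is isolated among the non-units and supplies
  its own factor 1 + x.\<close>

definition nonunits :: "nat \<Rightarrow> nat set" where
  "nonunits n = {x. 0 < x \<and> x < n \<and> \<not> coprime x n}"

lemma independence_poly_comaximal_nat:
  assumes "n \<ge> 2"
  shows "independence_poly (with_proj (comaximal_nat n)) = monom (int (totient n)) 1 +
    [:1, 1:] * independence_poly (with_proj (comaximal_nat n) \<restriction> nonunits n)"
proof -
  let ?G = "with_proj (comaximal_nat n)"
  let ?H = "?G \<restriction> ({..<n} - totatives n)"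
  \<comment> \<open>\<open>totatives n\<close> is taken from 1 to \<open>n\<close>, residues from 0
    to \<open>n - 1\<close>; for \<open>n \<ge> 2\<close> neither 0 nor \<open>n\<close> is coprime
    to \<open>n\<close>, so the two ranges give the same set.\<close>
  have tot: "totatives n = {x. x < n \<and> coprime x n}"
    using assms by (auto simp: totatives_def le_less intro!: gr0I)
  have "independence_poly ?G = monom (int (card (totatives n))) 1 +
      independence_poly (?G \<restriction> (verts ?G - totatives n))"
    \<comment> \<open>For a unit \<open>u\<close>, \<open>gcd u v\<close> divides \<open>u\<close>
      and is therefore coprime to \<open>n\<close>, whatever \<open>v\<close> is.\<close>
    by (rule independence_poly_universal)
      (auto simp: comaximal_nat_def tot intro: coprime_divisors[OF gcd_dvd1 dvd_refl])
  then have "independence_poly ?G = monom (int (totient n)) 1 + independence_poly ?H"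
    by (simp add: totient_def comaximal_nat_def)
  \<comment> \<open>Since \<open>gcd 0 y = y\<close>, the vertex 0 has only units as neighbours, and
    these are gone.\<close>
  also have "independence_poly ?H =
      [:1, 1:] ^ card {0::nat} * independence_poly (?H \<restriction> (verts ?H - {0}))"
    using assms by (intro independence_poly_isolated) (auto simp: comaximal_nat_def tot)
  also have "verts ?H - {0} = nonunits n"
    by (auto simp: nonunits_def tot)
  also have "?H \<restriction> nonunits n = ?G \<restriction> nonunits n"
    by (auto simp: induce_subgraph_def nonunits_def tot)
  finally show ?thesis by simp
qed

section \<open>The nonzero non-units as a copy of \<open>G2\<close>\<close>

text \<open>Both sides say that \<open>x\<close>, \<open>y\<close> and \<open>n\<close> have no
  common divisor besides 1.\<close>

lemma coprime_gcd_gcd_iff: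
  "coprime (gcd x n) (gcd y n) \<longleftrightarrow> coprime (gcd x y) n" for n x y :: nat
proof -
  have "gcd (gcd x n) (gcd y n) = gcd (gcd x y) n"
    by (rule dvd_antisym) (meson dvd_trans gcd_dvd1 gcd_dvd2 gcd_greatest)+
  then show ?thesis unfolding coprime_iff_gcd_eq_1 by (rule arg_cong)
qed

text \<open>A vertex \<open>(d, u)\<close> of \<^term>\<open>G2 n\<close> stands for one of the \<open>\<phi>(n/d)\<close> residues \<open>x\<close> with
  \<open>gcd x n = d\<close>.\<close>

lemma pverts_G2: "pverts (G2 n) = Sigma (proper_divisors n) (\<lambda>d. {..<totient (n div d)})"
  by (simp add: G2_def joined_union_def coprime_divisor_graph_def edgeless_graph_def)

text \<open>The parts are edgeless, so only the divisors decide adjacency. Coprime proper divisors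
  are automatically distinct, since 1 is not a proper divisor.\<close>

lemma parcs_G2: "parcs (G2 n) = {(x, y). x \<in> pverts (G2 n) \<and> y \<in> pverts (G2 n) \<and>
    coprime (fst x) (fst y)}"
  unfolding pverts_G2 G2_def joined_union_def coprime_divisor_graph_def edgeless_graph_def
    coprime_iff_gcd_eq_1[symmetric]
  by (auto simp: proper_divisors_def)

lemma finite_pverts_G2: "n > 0 \<Longrightarrow> finite (pverts (G2 n))"
  by (auto simp: pverts_G2 proper_divisors_def)

lemma symmetric_G2: "symmetric (with_proj (G2 n))"
  by (auto simp: symmetric_def parcs_G2 coprime_commute intro: symI)

text \<open>The fibre of \<open>gcd x n\<close> over a proper divisor \<open>d\<close> has
  \<open>totient (n div d)\<close> elements, as many as the part of \<open>G2 n\<close> over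
  \<open>d\<close>. Bijections chosen arbitrarily on the fibres are glued together; only the first
  component is recorded, because adjacency in \<open>G2 n\<close> depends on nothing else.\<close>

lemma nonunits_bij_G2:
  assumes "n \<ge> 2"
  obtains f where "bij_betw f (nonunits n) (pverts (G2 n))" "\<And>x. fst (f x) = gcd x n"
proof -
  let ?F = "\<lambda>d. {x \<in> nonunits n. gcd x n = d}"
  have "\<exists>h. bij_betw h (?F d) {..<totient (n div d)}" if "d \<in> proper_divisors n" for d
  proof -
    \<comment> \<open>The known count ranges over 1 to \<open>n\<close>. A proper \<open>d\<close>
      excludes both \<open>x = n\<close>, where the gcd is \<open>n\<close>, and the units, where it
      is 1.\<close>
    have "?F d = {x \<in> {0<..n}. gcd x n = d}"
      using that unfolding nonunits_def proper_divisors_def coprime_iff_gcd_eq_1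
      by (auto simp: le_less)
    then have "card (?F d) = totient (n div d)"
      using that assms card_gcd_eq_totient[of n d] by (simp add: proper_divisors_def)
    then show ?thesis
      by (intro finite_same_card_bij) (auto simp: nonunits_def)
  qed
  then obtain h where h: "\<And>d. d \<in> proper_divisors n \<Longrightarrow> bij_betw (h d) (?F d) {..<totient (n div d)}"
    by metis
  let ?f = "\<lambda>x. (gcd x n, h (gcd x n) x)"
  have D: "gcd x n \<in> proper_divisors n" if "x \<in> nonunits n" for x
  proof -
    have "gcd x n < n"
      by (rule le_less_trans[OF gcd_le1_nat]) (use that in \<open>auto simp: nonunits_def\<close>)
    then have "gcd x n \<noteq> n" by simp
    with that show ?thesis
      unfolding nonunits_def proper_divisors_def coprime_iff_gcd_eq_1 by simp
  qed
  have "bij_betw ?f (nonunits n) (pverts (G2 n))"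
    unfolding bij_betw_def
  proof
    show "inj_on ?f (nonunits n)"
    proof (rule inj_onI)
      fix x y assume xy: "x \<in> nonunits n" "y \<in> nonunits n" "?f x = ?f y"
      then have "inj_on (h (gcd x n)) (?F (gcd x n))" using D h by (meson bij_betw_imp_inj_on)
      then show "x = y" by (rule inj_onD) (use xy in auto)
    qed
    show "?f ` nonunits n = pverts (G2 n)"
    proof (intro equalityI subsetI)
      fix p assume "p \<in> ?f ` nonunits n"
      then obtain x where "x \<in> nonunits n" "p = ?f x" by blast
      then show "p \<in> pverts (G2 n)"
        using D h[OF D] by (auto simp: pverts_G2 bij_betw_def)
    next
      fix p assume "p \<in> pverts (G2 n)"
      then obtain d u where p: "p = (d, u)" "d \<in> proper_divisors n" "u \<in> {..<totient (n div d)}"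
        by (auto simp: pverts_G2)
      then have "u \<in> h d ` ?F d" using bij_betw_imp_surj_on[OF h] by simp
      then obtain x where "x \<in> ?F d" "u = h d x" by blast
      then show "p \<in> ?f ` nonunits n" using p by auto
    qed
  qed
  then show thesis by (rule that) simp
qed

section \<open>Isolated vertices, the radical of n, and the two formulas\<close>

text \<open>If a prime \<open>q\<close> divides \<open>n\<close> but not \<open>x\<close>, then
  \<open>q\<close> itself is a neighbour of \<open>x\<close>. Conversely, every non-unit
  \<open>y\<close> shares a prime with \<open>n\<close>; if that prime also divides
  \<open>x\<close>, then \<open>x\<close> and \<open>y\<close> are not comaximal.\<close>

lemma nonunits_isolated_iff:
  assumes "x \<in> nonunits n"
  shows "(\<forall>y\<in>nonunits n. \<not> coprime (gcd x y) n) \<longleftrightarrow> (\<forall>q. prime q \<and> q dvd n \<longrightarrow> q dvd x)"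
proof safe
  fix q assume iso: "\<forall>y\<in>nonunits n. \<not> coprime (gcd x y) n" and q: "prime q" "q dvd n"
  show "q dvd x"
  proof (rule ccontr)
    assume "\<not> q dvd x"
    with q have cop: "coprime q x" by (simp add: prime_imp_coprime)
    \<comment> \<open>Otherwise \<open>x\<close> would be coprime to \<open>n\<close>, that is, a
      unit.\<close>
    moreover have "q \<noteq> n" using cop assms by (auto simp: nonunits_def coprime_commute)
    moreover have "q \<le> n" using q assms by (auto simp: nonunits_def intro: dvd_imp_le)
    ultimately have "q \<in> nonunits n"
      using q by (auto simp: nonunits_def prime_gt_0_nat dest: coprime_common_divisor[of _ _ q])
    with iso have "\<not> coprime (gcd x q) n" ..
    moreover have "gcd x q = 1" using cop by (metis coprime_imp_gcd_eq_1 gcd.commute)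
    ultimately show False by simp
  qed
next
  fix y assume rad: "\<forall>q. prime q \<and> q dvd n \<longrightarrow> q dvd x"
    and y: "y \<in> nonunits n" and cop: "coprime (gcd x y) n"
  from y have "gcd y n \<noteq> 1" unfolding nonunits_def coprime_iff_gcd_eq_1 by simp
  then obtain q where "prime q" "q dvd gcd y n" using prime_factor_nat by blast
  moreover with rad have "q dvd gcd x y" by simp
  ultimately show False using cop by (meson coprime_common_divisor dvd_gcdD2 not_prime_unit)
qed

text \<open>The common source of both formulas: \<open>G\<close> is carried to
  \<open>comaximal_nat n\<close>, units and 0 are split off there, and the rest is identified with
  \<open>G2 n\<close>.\<close>

lemma independence_poly_comaximal_graph:
  assumes n: "n \<ge> 2"
    and "digraph_iso G (with_proj (comaximal_graph (residue_ring (int n))))"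
  shows "independence_poly G =
    monom (int (totient n)) 1 + [:1, 1:] * independence_poly (with_proj (G2 n))"
proof -
  let ?H = "with_proj (comaximal_nat n)"
  obtain f where f: "bij_betw f (verts G) (pverts (comaximal_graph (residue_ring (int n))))"
    and adj: "\<And>u v. u \<in> verts G \<Longrightarrow> v \<in> verts G \<Longrightarrow>
      u \<rightarrow>\<^bsub>G\<^esub> v \<longleftrightarrow> (f u, f v) \<in> parcs (comaximal_graph (residue_ring (int n)))"
    using digraph_isoE[OF assms(2)] by auto
  have bij: "bij_betw (nat \<circ> f) (verts G) (verts ?H)"
    using bij_betw_trans[OF f comaximal_graph_residue_ring(1)[OF n]] by simp
  then have "finite (verts G)" by (rule bij_betw_finite[THEN iffD2]) (simp add: comaximal_nat_def)
  then have "independence_poly G = independence_poly ?H"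
    using bij
  proof (rule independence_poly_cong)
    fix u v assume "u \<in> verts G" "v \<in> verts G"
    with f adj show "u \<rightarrow>\<^bsub>G\<^esub> v \<longleftrightarrow> (nat \<circ> f) u \<rightarrow>\<^bsub>?H\<^esub> (nat \<circ> f) v"
      by (simp add: comaximal_graph_residue_ring(2)[OF n] bij_betwE)
  qed
  also have "\<dots> = monom (int (totient n)) 1 + [:1, 1:] * independence_poly (?H \<restriction> nonunits n)"
    by (rule independence_poly_comaximal_nat[OF n])
  also have "independence_poly (?H \<restriction> nonunits n) = independence_poly (with_proj (G2 n))"
  proof -
    obtain g where g: "bij_betw g (nonunits n) (pverts (G2 n))" "\<And>x. fst (g x) = gcd x n"
      using nonunits_bij_G2[OF n] by blast
    show ?thesis
    proof (rule independence_poly_cong)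
      fix u v assume "u \<in> verts (?H \<restriction> nonunits n)" "v \<in> verts (?H \<restriction> nonunits n)"
      then have uv: "u \<in> nonunits n" "v \<in> nonunits n" by simp_all
      \<comment> \<open>For \<open>u = v\<close> both sides fail: there are no loops on the left,
        and \<open>gcd u u = u\<close> is not coprime to \<open>n\<close> on the right.\<close>
      then show "u \<rightarrow>\<^bsub>?H \<restriction> nonunits n\<^esub> v \<longleftrightarrow> g u \<rightarrow>\<^bsub>with_proj (G2 n)\<^esub> g v"
        using g bij_betwE[OF g(1)] by (auto simp: parcs_G2 coprime_gcd_gcd_iff comaximal_nat_def nonunits_def)
    qed (use g in \<open>auto simp: nonunits_def\<close>)
  qed
  finally show ?thesis .
qed

text \<open>The second condition on \<open>r\<close> says that \<open>r\<close> is the radical of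
  \<open>n\<close>, phrased through its multiples. The isolated vertices correspond to the multiples
  of \<open>r\<close> strictly between 0 and \<open>n = r * m\<close>.\<close>

lemma card_isolated_G2:
  assumes n: "n \<ge> 2" and r: "n = r * m" "\<And>x. r dvd x \<longleftrightarrow> (\<forall>q. prime q \<and> q dvd n \<longrightarrow> q dvd x)"
  shows "card {v \<in> pverts (G2 n). \<forall>w\<in>pverts (G2 n). (v, w) \<notin> parcs (G2 n)} = m - 1"
    (is "card ?Z = _")
proof -
  obtain g where g: "bij_betw g (nonunits n) (pverts (G2 n))" "\<And>x. fst (g x) = gcd x n"
    using nonunits_bij_G2[OF n] by blast
  have img: "pverts (G2 n) = g ` nonunits n" using g by (simp add: bij_betw_def)
  have rpos: "r > 0" using n r by (cases r) auto
  obtain q where q: "prime q" "q dvd n" using n prime_factor_nat[of n] by auto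
  have iso: "(\<forall>w\<in>pverts (G2 n). (g x, w) \<notin> parcs (G2 n)) \<longleftrightarrow> r dvd x"
    if x: "x \<in> nonunits n" for x
  proof -
    have "(\<forall>w\<in>pverts (G2 n). (g x, w) \<notin> parcs (G2 n)) \<longleftrightarrow>
        (\<forall>y\<in>nonunits n. \<not> coprime (gcd x n) (gcd y n))"
      using x g(2) by (auto simp: parcs_G2 img)
    also have "\<dots> \<longleftrightarrow> (\<forall>y\<in>nonunits n. \<not> coprime (gcd x y) n)"
      by (simp add: coprime_gcd_gcd_iff)
    finally show ?thesis using nonunits_isolated_iff[OF x] r(2) by simp
  qed
  \<comment> \<open>Some prime \<open>q\<close> divides \<open>n\<close>, hence every multiple of
    \<open>r\<close>, so such a multiple is never a unit.\<close>
  have mult: "x \<in> nonunits n \<longleftrightarrow> 0 < x \<and> x < n" if "r dvd x" for x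
  proof -
    have "q dvd x" using that q r(2) by blast
    with q have "\<not> coprime x n" by (meson coprime_common_divisor not_prime_unit)
    then show ?thesis by (simp add: nonunits_def)
  qed
  have "?Z = g ` {x \<in> nonunits n. r dvd x}" using iso unfolding img by blast
  moreover have "inj_on g {x \<in> nonunits n. r dvd x}"
    using g by (auto simp: bij_betw_def intro: inj_on_subset)
  \<comment> \<open>The factor 0 would give 0 and the factor \<open>m\<close> would give
    \<open>n\<close>; \<open>m - 1\<close> factors remain.\<close>
  moreover have "{x \<in> nonunits n. r dvd x} = (*) r ` {1..<m}"
    using mult rpos by (auto simp: r(1) elim!: dvdE)
  ultimately show ?thesis
    using rpos by (simp add: card_image inj_on_def)
qed

theorem theorem3p2:
  fixes G :: "('a, 'b) pre_digraph" and n :: nat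
  assumes "n \<ge> 2"
    and "digraph_iso G (with_proj (comaximal_graph (residue_ring (int n))))"
  shows
    "((\<exists>P. finite P \<and> (\<forall>p\<in>P. prime p) \<and> n = \<Prod>P) \<longrightarrow>
       independence_poly G =
         monom (int (totient n)) 1 + [:1, 1:] * independence_poly (with_proj (G2 n))) \<and>
     (\<forall>(k::nat) (p :: nat \<Rightarrow> nat) (e :: nat \<Rightarrow> nat).
       inj_on p {1..k} \<and> (\<forall>i\<in>{1..k}. prime (p i)) \<and> (\<forall>i\<in>{1..k}. e i > 0) \<and>
       n = (\<Prod>i = 1..k. p i ^ e i) \<longrightarrow>
       independence_poly G =
         monom (int (totient n)) 1 +
         [:1, 1:] ^ (\<Prod>i = 1..k. p i ^ (e i - 1)) *
           independence_poly (remove_isolated (with_proj (G2 n))))"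
proof (intro conjI allI impI)
  note main = independence_poly_comaximal_graph[OF assms]
  show "independence_poly G =
      monom (int (totient n)) 1 + [:1, 1:] * independence_poly (with_proj (G2 n))"
    by (rule main)
  fix k :: nat and p e :: "nat \<Rightarrow> nat"
  assume "inj_on p {1..k} \<and> (\<forall>i\<in>{1..k}. prime (p i)) \<and> (\<forall>i\<in>{1..k}. e i > 0) \<and>
    n = (\<Prod>i = 1..k. p i ^ e i)"
  then have inj: "inj_on p {1..k}" and pr: "\<And>i. i \<in> {1..k} \<Longrightarrow> prime (p i)"
    and e: "\<And>i. i \<in> {1..k} \<Longrightarrow> e i > 0" and n: "n = (\<Prod>i = 1..k. p i ^ e i)" by auto
  \<comment> \<open>\<open>r\<close> is the radical of \<open>n\<close> and \<open>m\<close> the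
    cofactor \<open>n / r\<close>; as all \<open>e i\<close> are positive, the exponents
    \<open>e i - 1\<close> are not truncated.\<close>
  define r where "r = (\<Prod>i = 1..k. p i)"
  define m where "m = (\<Prod>i = 1..k. p i ^ (e i - 1))"
  have "n = (\<Prod>i = 1..k. p i * p i ^ (e i - 1))"
    unfolding n using e by (intro prod.cong refl) (simp flip: power_Suc)
  then have "n = r * m" by (simp add: r_def m_def prod.distrib)
  have primes: "prime q \<and> q dvd n \<longleftrightarrow> q \<in> p ` {1..k}" for q
  proof safe
    assume q: "prime q" "q dvd n"
    have "\<exists>i\<in>{1..k}. q dvd p i ^ e i"
      using q(2) unfolding n by (rule prime_dvd_prod_iff[OF finite_atLeastAtMost q(1), THEN iffD1])
    then obtain i where i: "i \<in> {1..k}" "q dvd p i ^ e i" ..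
    have "q = p i"
      using q(1) pr[OF i(1)] prime_dvd_power[OF q(1) i(2)] by (rule primes_dvd_imp_eq)
    with i(1) show "q \<in> p ` {1..k}" by simp
  next
    fix i assume i: "i \<in> {1..k}"
    then show "prime (p i)" by (rule pr)
    have "p i dvd p i ^ e i" using e[OF i] by simp
    also have "\<dots> dvd n" unfolding n using i by (intro dvd_prodI) auto
    finally show "p i dvd n" .
  qed
  have rad: "r dvd x \<longleftrightarrow> (\<forall>q. prime q \<and> q dvd n \<longrightarrow> q dvd x)" for x
  proof
    assume "r dvd x"
    then show "\<forall>q. prime q \<and> q dvd n \<longrightarrow> q dvd x"
      unfolding primes r_def by (auto intro: dvd_trans[OF dvd_prodI])
  next
    assume "\<forall>q. prime q \<and> q dvd n \<longrightarrow> q dvd x"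
    \<comment> \<open>Distinct primes are pairwise coprime, so the congruences modulo each
      \<open>p i\<close> combine to one modulo their product.\<close>
    then have "[x = 0] (mod \<Prod>i = 1..k. p i)"
      unfolding primes
      by (intro cong_cong_prod_coprime_nat)
        (use inj pr in \<open>auto simp: cong_0_iff inj_on_eq_iff intro!: primes_coprime\<close>)
    then show "r dvd x" by (simp add: r_def cong_0_iff)
  qed
  have "m > 0" unfolding m_def using pr by (auto intro!: prod_pos simp: prime_gt_0_nat)
  have "independence_poly (with_proj (G2 n)) =
      [:1, 1:] ^ (m - 1) * independence_poly (remove_isolated (with_proj (G2 n)))"
    using independence_poly_remove_isolated[of "with_proj (G2 n)"] assms(1)
    by (simp add: finite_pverts_G2 symmetric_G2 card_isolated_G2[OF assms(1) \<open>n = r * m\<close> rad])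
  \<comment> \<open>The \<open>m - 1\<close> isolated vertices of \<open>G2 n\<close> and the
    residue 0 together yield \<open>m\<close> factors 1 + x; \<open>m > 0\<close> makes
    \<open>m - 1\<close> a true predecessor.\<close>
  moreover have "[:1, 1:] ^ m = [:1, 1:] * [:1, 1 :: int:] ^ (m - 1)"
    using \<open>m > 0\<close> by (simp flip: power_Suc)
  ultimately have "[:1, 1:] * independence_poly (with_proj (G2 n)) =
      [:1, 1:] ^ m * independence_poly (remove_isolated (with_proj (G2 n)))"
    by (simp only: mult.assoc)
  then show "independence_poly G = monom (int (totient n)) 1 +
      [:1, 1:] ^ (\<Prod>i = 1..k. p i ^ (e i - 1)) *
        independence_poly (remove_isolated (with_proj (G2 n)))"
    by (simp only: main m_def)
qed

end
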